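(* Let $X=(X_1,\dots,X_d)$ be a random vector in $\mathbb{R}^d$ with independent coordinates and let $f:\mathbb{R}^d\to\mathbb{R}$ be such that $f(X)\in L^2$. Let $i\in\{1,\dots,d\}$, let $[a_i,b_i]$ be a finite interval, and assume that the distribution $\mu_i$ of $X_i$ belongs to $\mathcal{P}(a_i,b_i)$ and that the main effect $f_i$ belongs to $\mathscr{C}^{1,2}_*(a_i,b_i)$ and satisfies $f_i'(a_i)\ne0$ and $f_i'(b_i)\neq0$. Assume moreover that $\frac{\partial f}{\partial x_i}(X)\in L^2$. Let $X^{(1)},\dots,X^{(n)}$ be an i.i.d. sample generated from $X$, and let $\widehat{f_i}$ (depending on $n$) be an estimator constructed with respect to this sample. Assume that, almost surely: (i) $\widehat{f_i}$ is centered with respect to $\mu_i$; (ii) $\widehat{f_i}\in\mathscr{C}^{1,2}_*(a_i,b_i)$ satisfies $\widehat{f_i}'(a_i)\neq0$ and $\widehat{f_i}'(b_i)\ne0$; (iii) $\widehat{f_i}$ converges uniformly to $f_i$ on $[a_i,b_i]$ as $n\to\infty$; (iv) $\widehat{f_i}'$ converges uniformly to $f_i'$ on $[a_i,b_i]$ as $n\to\infty$. Then, almost surely, the data-driven weight $\widehat{w_i}=w_{\widehat{f_i}}$ converges uniformly to $w_{f_i}$ on $[a_i,b_i]$ as $n\to\infty$. Moreover, the Monte-Carlo estimator $$\widehat{\nu_i}=\frac1n\sum_{k=1}^n\widehat{w_i}\big(X_i^{(k)}\big)\left|\frac{\partial f}{\partial x_i}\big(X^{(k)}\big)\right|^2$$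 converges almost surely to $\nu_{i,w_{f_i}}$ as $n\to\infty$.
   Context: For finite $a<b$: $\mathscr{C}^{0,1}_+(a,b)$: the set of functions that are continuous and piecewise $\mathscr{C}^1$ on $[a,b]$ and positive on $(a,b)$. $\mathscr{C}^{1,2}_*(a,b)$: the set of functions $g$ such that $g'\in\mathscr{C}^{0,1}_+(a,b)$ or $-g'\in\mathscr{C}^{0,1}_+(a,b)$. Derivatives at endpoints are one-sided. $\mathcal{P}(a,b)$: the set of probability measures on $[a,b]$ having a Lebesgue density $\rho\in\mathscr{C}^{0,1}_+(a,b)$ with $\rho(a)>0$ and $\rho(b)>0$. A function $g$ is centered with respect to $\mu$ if $\int g\,d\mu=0$. For $g\in\mathscr{C}^{1,2}_*(a_i,b_i)$ centered with respect to $\mu_i$ (with density $\rho_i$) and such that $g'(a_i)\ne0$, $g'(b_i)\neq 0$, the weight $w_g$ is $$w_g(x)=-\frac{1}{g'(x)\rho_i(x)}\int_{a_i}^{x}g(y)\rho_i(y)\,dy,\qquad x\in[a_i,b_i].$$ The main effect of $X_i$ is $f_i(X_i)=\mathbb{E}[f(X)\mid X_i]-\mathbb{E}[f(X)]$, which defines the function $f_i$ on $[a_i,b_i]$ (it is centered with respect to $\mu_i$). For a weight $w$, the weighted DGSM index is $\nu_{i,w}=\mathbb{E}\left[w(X_i)\left(\frac{\partial f}{\partial x_i}(X)\right)^2\right]$. The samples $X^{(1)},X^{(2)},\dots$ for all $n$ are taken from one i.i.d. sequence with the law of $X$, and $X_i^{(k)}$ denotes the $i$-th coordinate of $X^{(k)}$.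 *)

theory Defs
  imports "HOL-Probability.Probability"
begin

text \<open>
  A function on \<open>[a,b]\<close> is a total function \<open>real \<Rightarrow> real\<close> whose values outside \<open>[a,b]\<close> are
  irrelevant.  The derivative within \<open>{a..b}\<close> is one-sided at the endpoints.
\<close>

definition deriv_on :: "real \<Rightarrow> real \<Rightarrow> (real \<Rightarrow> real) \<Rightarrow> real \<Rightarrow> real" where
  "deriv_on a b g x = vector_derivative g (at x within {a..b})"

text \<open>
  \<open>piecewise_C1_differentiable_on\<close> is not used because it puts no condition on the derivative near
  the breakpoints, so it admits \<open>sqrt\<close> on \<open>[0,1]\<close>.  Here the function is continuously
  differentiable, one-sidedly at the ends, on every closed piece of a finite subdivision.
\<close>

definition piecewise_C1 :: "real \<Rightarrow> real \<Rightarrow> (real \<Rightarrow> real) \<Rightarrow> bool" where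
  "piecewise_C1 a b h \<longleftrightarrow>
     (\<exists>(m::nat) (t::nat \<Rightarrow> real). t 0 = a \<and> t m = b \<and>
        (\<forall>j<m. t j < t (Suc j) \<and>
           (\<exists>D. continuous_on {t j..t (Suc j)} D \<and>
              (\<forall>x\<in>{t j..t (Suc j)}.
                 (h has_real_derivative D x) (at x within {t j..t (Suc j)})))))"

definition C01_plus :: "real \<Rightarrow> real \<Rightarrow> (real \<Rightarrow> real) set" where
  "C01_plus a b = {h. continuous_on {a..b} h \<and> piecewise_C1 a b h \<and> (\<forall>x\<in>{a<..<b}. 0 < h x)}"

definition C12_star :: "real \<Rightarrow> real \<Rightarrow> (real \<Rightarrow> real) set" where
  "C12_star a b = {g. g differentiable_on {a..b} \<and>
     (deriv_on a b g \<in> C01_plus a b \<or> (\<lambda>x. - deriv_on a b g x) \<in> C01_plus a b)}"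

definition regular_density :: "real \<Rightarrow> real \<Rightarrow> real measure \<Rightarrow> (real \<Rightarrow> real) \<Rightarrow> bool" where
  "regular_density a b \<mu> \<rho> \<longleftrightarrow>
     \<rho> \<in> C01_plus a b \<and> 0 < \<rho> a \<and> 0 < \<rho> b \<and>
     \<mu> = density lborel (\<lambda>x. ennreal (indicator {a..b} x * \<rho> x))"

definition P_class :: "real \<Rightarrow> real \<Rightarrow> real measure set" where
  "P_class a b = {\<mu>. prob_space \<mu> \<and> sets \<mu> = sets borel \<and> (\<exists>\<rho>. regular_density a b \<mu> \<rho>)}"

definition centered :: "real \<Rightarrow> real \<Rightarrow> real measure \<Rightarrow> (real \<Rightarrow> real) \<Rightarrow> bool" where
  "centered a b \<mu> g \<longleftrightarrow> set_integrable \<mu> {a..b} g \<and> (LINT x:{a..b}|\<mu>. g x) = 0"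

text \<open>
  The weight is set to zero outside \<open>[a,b]\<close>: otherwise the junk values of \<open>\<rho>\<close> there could destroy
  measurability of the weight, although they carry no mass.
\<close>

definition weight :: "real \<Rightarrow> real \<Rightarrow> (real \<Rightarrow> real) \<Rightarrow> (real \<Rightarrow> real) \<Rightarrow> real \<Rightarrow> real" where
  "weight a b \<rho> g x =
     (if x \<in> {a..b}
      then - (1 / (deriv_on a b g x * \<rho> x)) * (LBINT y:{a..x}. g y * \<rho> y)
      else 0)"

definition L2_rv :: "'w measure \<Rightarrow> ('w \<Rightarrow> real) \<Rightarrow> bool" where
  "L2_rv M Z \<longleftrightarrow> Z \<in> borel_measurable M \<and> integrable M (\<lambda>\<omega>. (Z \<omega>)\<^sup>2)"

text \<open>
  \<open>g\<close> is a main effect function of the \<open>i\<close>-th coordinate; the conditional expectation is taken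
  with respect to the sigma-algebra generated by that coordinate.
\<close>

definition main_effect ::
  "'w measure \<Rightarrow> ('w \<Rightarrow> real ^ 'd) \<Rightarrow> (real ^ 'd \<Rightarrow> real) \<Rightarrow> 'd \<Rightarrow> (real \<Rightarrow> real) \<Rightarrow> bool" where
  "main_effect M X f i g \<longleftrightarrow>
     (AE \<omega> in M. g (X \<omega> $ i) =
        real_cond_exp M (vimage_algebra (space M) (\<lambda>\<omega>. X \<omega> $ i) borel) (\<lambda>\<omega>. f (X \<omega>)) \<omega>
        - (\<integral>\<omega>'. f (X \<omega>') \<partial>M))"

text \<open>
  \<open>Df\<close> is the partial derivative of \<open>f\<close> in the \<open>i\<close>-th variable, as a Borel function that is
  determined almost everywhere for the law \<open>\<mu>\<close>; \<open>f\<close> need not be differentiable off a null set.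
\<close>

definition partial_derivative ::
  "(real ^ 'd) measure \<Rightarrow> (real ^ 'd \<Rightarrow> real) \<Rightarrow> 'd \<Rightarrow> (real ^ 'd \<Rightarrow> real) \<Rightarrow> bool" where
  "partial_derivative \<mu> f i Df \<longleftrightarrow>
     Df \<in> borel_measurable borel \<and>
     (AE x in \<mu>. ((\<lambda>t. f (x + t *\<^sub>R axis i 1)) has_real_derivative Df x) (at 0))"

text \<open>The sample points carry the indices \<open>1, 2, \<dots>\<close>; \<open>Xs 0\<close> is never used.\<close>

definition iid_with_law ::
  "'w measure \<Rightarrow> (nat \<Rightarrow> 'w \<Rightarrow> real ^ 'd) \<Rightarrow> (real ^ 'd) measure \<Rightarrow> bool" where
  "iid_with_law M Xs \<mu> \<longleftrightarrow>
     prob_space.indep_vars M (\<lambda>_. borel) Xs {1..} \<and> (\<forall>k\<ge>1. distr M borel (Xs k) = \<mu>)"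

definition sample :: "(nat \<Rightarrow> 'w \<Rightarrow> real ^ 'd) \<Rightarrow> nat \<Rightarrow> 'w \<Rightarrow> (real ^ 'd) list" where
  "sample Xs n \<omega> = map (\<lambda>k. Xs k \<omega>) [1..<Suc n]"

definition dgsm ::
  "'w measure \<Rightarrow> ('w \<Rightarrow> real ^ 'd) \<Rightarrow> 'd \<Rightarrow> (real ^ 'd \<Rightarrow> real) \<Rightarrow> (real \<Rightarrow> real) \<Rightarrow> real" where
  "dgsm M X i Df w = (\<integral>\<omega>. w (X \<omega> $ i) * (Df (X \<omega>))\<^sup>2 \<partial>M)"

definition dgsm_mc ::
  "(nat \<Rightarrow> 'w \<Rightarrow> real ^ 'd) \<Rightarrow> 'd \<Rightarrow> (real ^ 'd \<Rightarrow> real) \<Rightarrow> (real \<Rightarrow> real) \<Rightarrow> nat \<Rightarrow> 'w \<Rightarrow> real" where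
  "dgsm_mc Xs i Df w n \<omega> = (1 / real n) * (\<Sum>k=1..n. w (Xs k \<omega> $ i) * \<bar>Df (Xs k \<omega>)\<bar>\<^sup>2)"

end

theory Submission
  imports Defs
begin

text \<open>
  On \<open>[a,b]\<close> the derivative of the main effect and the density are continuous and do not vanish, so
  the denominator of the weight is bounded away from zero and uniform convergence passes to the
  quotient. Hence replacing the estimated weight by the limit weight changes the Monte Carlo
  average by at most the uniform distance of the weights times the average of the squared partial
  derivatives, which converges. What remains is the strong law of large numbers for integrable
  i.i.d. variables: after subtracting slightly more than the mean, the partial sums are almost
  surely bounded above, by a maximal inequality.
\<close>

section \<open>Running maxima of partial sums\<close>

text \<open>
  The maximum of \<open>0\<close> and the first \<open>n\<close> partial sums of \<open>x\<close>, written as a recursion through the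
  shifted sequence, so that prepending an independent copy of the first term acts on it explicitly.
\<close>

primrec max_partial_sum :: "nat \<Rightarrow> (nat \<Rightarrow> real) \<Rightarrow> real" where
  "max_partial_sum 0 x = 0"
| "max_partial_sum (Suc n) x = max 0 (x 0 + max_partial_sum n (\<lambda>k. x (Suc k)))"

lemma max_partial_sum_nonneg: "0 \<le> max_partial_sum n x"
  by (cases n) auto

lemma max_partial_sum_Suc_le: "max_partial_sum n x \<le> max_partial_sum (Suc n) x"
proof (induction n arbitrary: x)
  case (Suc n)
  show ?case
    using Suc[of "\<lambda>k. x (Suc k)"] by auto
qed simp

lemma max_partial_sum_mono: "m \<le> n \<Longrightarrow> max_partial_sum m x \<le> max_partial_sum n x"
  by (rule lift_Suc_mono_le[of "\<lambda>n. max_partial_sum n x"]) (rule max_partial_sum_Suc_le)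

lemma sum_le_max_partial_sum: "(\<Sum>k<n. x k) \<le> max_partial_sum n x"
proof (induction n arbitrary: x)
  case (Suc n)
  show ?case
    using Suc[of "\<lambda>k. x (Suc k)"] by (simp add: sum.lessThan_Suc_shift del: sum.lessThan_Suc)
qed simp

lemma max_partial_sum_case_nat:
  "max_partial_sum (Suc n) (case_nat s x) = max 0 (s + max_partial_sum n x)"
  by simp

text \<open>Prepending \<open>s\<close> shifts the index by one and changes the maximum by at most
  \<open>\<bar>s\<bar>\<close>, so unboundedness depends only on the tail. Bounds range over the
  natural numbers to keep the event a countable combination of measurable sets.\<close>

lemma unbounded_max_partial_sum_case_nat:
  "(\<forall>B::nat. \<exists>n. real B < max_partial_sum n (case_nat s x)) \<longleftrightarrow>
   (\<forall>B::nat. \<exists>n. real B < max_partial_sum n x)" (is "?L \<longleftrightarrow> ?R")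
proof
  assume L: ?L
  show ?R
  proof
    fix B :: nat
    obtain C :: nat where C: "real B + \<bar>s\<bar> < real C"
      using reals_Archimedean2 by blast
    obtain n where n: "real C < max_partial_sum n (case_nat s x)"
      using L by blast
    then obtain m where "n = Suc m" by (cases n) auto
    with n C show "\<exists>n. real B < max_partial_sum n x"
      by (intro exI[of _ m]) (auto simp: max_def split: if_splits)
  qed
next
  assume R: ?R
  show ?L
  proof
    fix B :: nat
    obtain C :: nat where C: "real B + \<bar>s\<bar> < real C"
      using reals_Archimedean2 by blast
    obtain n where n: "real C < max_partial_sum n x"
      using R by blast
    with C show "\<exists>n. real B < max_partial_sum n (case_nat s x)"
      by (intro exI[of _ "Suc n"]) auto
  qed
qed

lemma measurable_PiM_shift:
  "(\<lambda>x k. x (Suc k)) \<in> (\<Pi>\<^sub>M i\<in>UNIV. N) \<rightarrow>\<^sub>M (\<Pi>\<^sub>M i\<in>UNIV. N)"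
  by (intro measurable_PiM_single') (auto simp: space_PiM PiE_iff)

lemma measurable_max_partial_sum:
  "max_partial_sum n \<in> borel_measurable (\<Pi>\<^sub>M i\<in>UNIV. borel)"
proof (induction n)
  case 0
  have "max_partial_sum 0 = (\<lambda>x. 0)" by (simp add: fun_eq_iff)
  then show ?case by simp
next
  case (Suc n)
  note [measurable] = Suc measurable_compose[OF measurable_PiM_shift Suc]
  have "max_partial_sum (Suc n) = (\<lambda>x. max 0 (x 0 + max_partial_sum n (\<lambda>k. x (Suc k))))"
    by (simp add: fun_eq_iff)
  then show ?case by simp
qed

section \<open>Integrals of functions of one coordinate on a product\<close>

lemma integrable_pair_fst:
  fixes f :: "'a \<Rightarrow> real"
  assumes "prob_space B" "integrable A f"
  shows "integrable (A \<Otimes>\<^sub>M B) (\<lambda>z. f (fst z))"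
  using integrable_distr[of fst "A \<Otimes>\<^sub>M B" A f] assms by (simp add: prob_space.distr_pair_fst)

text \<open>Swapping the factors reduces this to the first projection.\<close>

lemma integrable_pair_snd:
  fixes f :: "'b \<Rightarrow> real"
  assumes "prob_space A" "prob_space B" "integrable B f"
  shows "integrable (A \<Otimes>\<^sub>M B) (\<lambda>z. f (snd z))"
proof -
  interpret A: prob_space A by fact
  interpret B: prob_space B by fact
  interpret pair_sigma_finite B A ..
  have "integrable (B \<Otimes>\<^sub>M A) (\<lambda>z. f (fst z))"
    by (intro integrable_pair_fst assms)
  from integrable_product_swap[OF this] show ?thesis
    by (simp add: case_prod_beta')
qed

lemma integral_pair_snd:
  fixes f :: "'b \<Rightarrow> real"
  assumes "prob_space A" "prob_space B" "integrable B f"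
  shows "(\<integral>z. f (snd z) \<partial>(A \<Otimes>\<^sub>M B)) = integral\<^sup>L B f"
proof -
  interpret A: prob_space A by fact
  interpret B: prob_space B by fact
  interpret pair_sigma_finite A B ..
  show ?thesis
    using integral_fst'[OF integrable_pair_snd[OF assms]] by (simp add: A.prob_space)
qed

section \<open>Maximal inequality for independent identically distributed terms\<close>

text \<open>
  Garsia's argument for the maximal ergodic theorem. Let \<open>W\<^sub>n\<close> be the running maximum, \<open>s\<close> an
  independent first term, and \<open>U\<close> the shift invariant event that \<open>W\<^sub>n\<close> is unbounded. On \<open>U\<close> the
  increment from \<open>W\<^sub>n\<close> to the maximum of the prolonged sequence is \<open>max (- W\<^sub>n) s\<close>. Its integral over
  \<open>U\<close> is nonnegative, because prolonging preserves the law and the running maximum increases. It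
  tends to \<open>s\<close>, so \<open>E s \<cdot> P U\<close> is nonnegative by independence, and \<open>P U = 0\<close> when \<open>E s < 0\<close>.
\<close>

lemma AE_bounded_max_partial_sum:
  fixes N :: "real measure"
  assumes N: "prob_space N" and sets_N [measurable_cong]: "sets N = sets borel"
    and int: "integrable N (\<lambda>x. x)" and neg: "(\<integral>x. x \<partial>N) < 0"
  shows "AE x in (\<Pi>\<^sub>M i\<in>(UNIV::nat set). N). \<exists>B::nat. \<forall>n. max_partial_sum n x \<le> real B"
proof -
  interpret N: prob_space N by fact
  interpret sequence_space N
    by (intro sequence_space.intro product_prob_spaceI) fact
  interpret P: pair_prob_space N S ..
  have sets_S: "sets S = sets (\<Pi>\<^sub>M i\<in>(UNIV::nat set). borel)"
    by (intro sets_PiM_cong sets_N refl)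
  have [measurable]: "max_partial_sum n \<in> borel_measurable S" for n
    unfolding measurable_cong_sets[OF sets_S refl] by (rule measurable_max_partial_sum)
  define U where "U = {x \<in> space S. \<forall>B::nat. \<exists>n. real B < max_partial_sum n x}"
  have U [measurable]: "U \<in> sets S"
    unfolding U_def by measurable
  let ?W = "\<lambda>n x. max_partial_sum n x"
  have case_meas [measurable]: "(\<lambda>(s, x). case_nat s x) \<in> N \<Otimes>\<^sub>M S \<rightarrow>\<^sub>M S"
    by measurable
  \<comment> \<open>Prepending an independent draw from \<open>N\<close> to a sequence with law
    \<open>S\<close> gives law \<open>S\<close> again; both rules rewrite integrals along this
    map.\<close>
  have integrable_iter: "integrable S g \<longleftrightarrow> integrable (N \<Otimes>\<^sub>M S) (\<lambda>z. g (case_nat (fst z) (snd z)))"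
    and integral_iter: "integral\<^sup>L S g = (\<integral>z. g (case_nat (fst z) (snd z)) \<partial>(N \<Otimes>\<^sub>M S))"
    if [measurable]: "g \<in> borel_measurable S" for g :: "(nat \<Rightarrow> real) \<Rightarrow> real"
  proof -
    show "integrable S g \<longleftrightarrow> integrable (N \<Otimes>\<^sub>M S) (\<lambda>z. g (case_nat (fst z) (snd z)))"
      by (subst PiM_iter[symmetric], subst integrable_distr_eq) (auto simp: case_prod_beta')
    show "integral\<^sup>L S g = (\<integral>z. g (case_nat (fst z) (snd z)) \<partial>(N \<Otimes>\<^sub>M S))"
      by (subst PiM_iter[symmetric], subst integral_distr) (auto simp: case_prod_beta')
  qed
  have fst_int: "integrable (N \<Otimes>\<^sub>M S) (\<lambda>z. fst z)"
    using integrable_pair_fst[OF prob_space_axioms int] .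
  have W_int: "integrable S (?W n)" for n
  proof (induction n)
    case (Suc n)
    have "integrable (N \<Otimes>\<^sub>M S) (\<lambda>z. max 0 (fst z + ?W n (snd z)))"
      using integrable_pair_snd[OF N prob_space_axioms Suc] fst_int by auto
    then show ?case
      by (subst integrable_iter) (simp_all del: max_partial_sum.simps add: max_partial_sum_case_nat)
  qed simp
  \<comment> \<open>By shift invariance, membership of the prolonged sequence in \<open>U\<close>
    does not involve the new first term; hence the two are independent under the product
    measure.\<close>
  have U_case: "indicator U (case_nat (fst z) (snd z)) = (indicator U (snd z) :: real)"
    if "z \<in> space (N \<Otimes>\<^sub>M S)" for z
    using that measurable_space[OF case_meas that]
    by (auto simp: U_def indicator_def unbounded_max_partial_sum_case_nat space_pair_measure)
  let ?D = "\<lambda>n z. max (- ?W n (snd z)) (fst z) * indicator U (snd z)"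
  have U_snd: "integrable (N \<Otimes>\<^sub>M S) (\<lambda>z. g z * indicator U (snd z))"
    if "integrable (N \<Otimes>\<^sub>M S) g" for g :: "_ \<Rightarrow> real"
  proof -
    have [measurable]: "g \<in> borel_measurable (N \<Otimes>\<^sub>M S)"
      using that by auto
    show ?thesis
      using that by (rule Bochner_Integration.integrable_bound) (auto simp: indicator_def)
  qed
  have W_snd_int: "integrable (N \<Otimes>\<^sub>M S) (\<lambda>z. ?W n (snd z))" for n
    using integrable_pair_snd[OF N prob_space_axioms W_int] .
  have WU_int: "integrable S (\<lambda>x. ?W n x * indicator U x)" for n
    using integrable_real_mult_indicator[OF U W_int[of n]] by (simp add: mult.commute)
  have D_nonneg: "0 \<le> integral\<^sup>L (N \<Otimes>\<^sub>M S) (?D n)" for n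
  proof -
    have "(\<integral>x. ?W n x * indicator U x \<partial>S) \<le> (\<integral>x. ?W (Suc n) x * indicator U x \<partial>S)"
      by (intro integral_mono WU_int mult_right_mono max_partial_sum_Suc_le) auto
    also have "\<dots> = (\<integral>z. max 0 (fst z + ?W n (snd z)) * indicator U (snd z) \<partial>(N \<Otimes>\<^sub>M S))"
      by (subst integral_iter, simp del: max_partial_sum.simps)
         (intro Bochner_Integration.integral_cong refl, simp only: max_partial_sum_case_nat U_case)
    \<comment> \<open>Pointwise, \<open>max 0 (s + w) = max (- w) s + w\<close>, which isolates the
      increment.\<close>
    also have "\<dots> = (\<integral>z. ?D n z + ?W n (snd z) * indicator U (snd z) \<partial>(N \<Otimes>\<^sub>M S))"
      by (intro Bochner_Integration.integral_cong refl) (auto simp: indicator_def)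
    also have "\<dots> = integral\<^sup>L (N \<Otimes>\<^sub>M S) (?D n) + (\<integral>z. ?W n (snd z) * indicator U (snd z) \<partial>(N \<Otimes>\<^sub>M S))"
      by (intro Bochner_Integration.integral_add U_snd W_snd_int integrable_max
          Bochner_Integration.integrable_minus fst_int)
    also have "(\<integral>z. ?W n (snd z) * indicator U (snd z) \<partial>(N \<Otimes>\<^sub>M S)) = (\<integral>x. ?W n x * indicator U x \<partial>S)"
      using integral_pair_snd[OF N prob_space_axioms WU_int[of n]] .
    finally show ?thesis by simp
  qed
  have D_lim: "(\<lambda>n. ?D n z) \<longlonglongrightarrow> fst z * indicator U (snd z)" for z
  proof (cases "snd z \<in> U")
    case True
    \<comment> \<open>Once the running maximum exceeds \<open>\<bar>fst z\<bar>\<close>, the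
      truncation from below at its negative is inactive, so the sequence is eventually
      constant.\<close>
    obtain B :: nat where B: "\<bar>fst z\<bar> < real B"
      using reals_Archimedean2 by blast
    obtain m where m: "real B < ?W m (snd z)"
      using True unfolding U_def by blast
    have "?D n z = fst z * indicator U (snd z)" if "m \<le> n" for n
      using max_partial_sum_mono[OF that, of "snd z"] m B by auto
    then show ?thesis
      by (intro tendsto_eventually eventually_sequentiallyI[of m]) auto
  qed simp
  have "(\<lambda>n. integral\<^sup>L (N \<Otimes>\<^sub>M S) (?D n)) \<longlonglongrightarrow> (\<integral>z. fst z * indicator U (snd z) \<partial>(N \<Otimes>\<^sub>M S))"
  proof (rule integral_dominated_convergence)
    show "integrable (N \<Otimes>\<^sub>M S) (\<lambda>z. \<bar>fst z\<bar>)"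
      using fst_int by simp
    \<comment> \<open>The running maximum is nonnegative, so the truncation alters only negative
      values and moves them towards zero.\<close>
    show "AE z in N \<Otimes>\<^sub>M S. norm (?D n z) \<le> \<bar>fst z\<bar>" for n
      using max_partial_sum_nonneg[of n] by (intro AE_I2) (auto simp: indicator_def max_def)
  qed (use D_lim in auto)
  then have "0 \<le> (\<integral>z. fst z * indicator U (snd z) \<partial>(N \<Otimes>\<^sub>M S))"
    by (rule tendsto_lowerbound) (auto simp: D_nonneg)
  also have "\<dots> = (\<integral>x. x \<partial>N) * prob U"
    using P.integral_fst'[OF U_snd[OF fst_int]] by simp
  finally have "prob U = 0"
    using neg measure_nonneg[of S U] by (auto simp: zero_le_mult_iff)
  then have "AE x in S. x \<notin> U"
    by (subst prob_eq_0[symmetric]) auto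
  then show ?thesis
    using AE_space by eventually_elim (auto simp: U_def not_less)
qed

section \<open>Independence under reindexing\<close>

text \<open>Needed to turn a sample numbered from 1 into a sequence over all natural numbers.
  Injectivity ensures that distinct indices pick distinct members of the family.\<close>

lemma (in prob_space) indep_vars_reindex:
  assumes "indep_vars N X I" and "inj_on f J" and "f ` J \<subseteq> I"
  shows "indep_vars (\<lambda>j. N (f j)) (\<lambda>j. X (f j)) J"
proof -
  let ?F = "\<lambda>i. {X i -` A \<inter> space M |A. A \<in> sets (N i)}"
  have rv: "random_variable (N i) (X i)" if "i \<in> I" for i
    using assms(1) that unfolding indep_vars_def2 by blast
  have ind: "indep_sets ?F I"
    using assms(1) unfolding indep_vars_def2 by blast
  have "indep_sets (\<lambda>j. ?F (f j)) J"
  proof (rule indep_setsI)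
    fix j assume "j \<in> J"
    then show "?F (f j) \<subseteq> events"
      using ind assms(3) unfolding indep_sets_def by blast
  next
    fix A K assume K: "K \<noteq> {}" "K \<subseteq> J" "finite K" and A: "\<forall>j\<in>K. A j \<in> ?F (f j)"
    \<comment> \<open>The inverse of \<open>f\<close> relabels the sets \<open>A\<close> by indices
      in the image, where independence of the original family applies.\<close>
    let ?g = "inv_into J f"
    have g: "?g (f j) = j" if "j \<in> K" for j
      using assms(2) K(2) that by (auto intro: inv_into_f_f)
    have "prob (\<Inter>i\<in>f ` K. A (?g i)) = (\<Prod>i\<in>f ` K. prob (A (?g i)))"
    proof (rule indep_setsD[OF ind])
      show "\<forall>i\<in>f ` K. A (?g i) \<in> ?F i"
        using A g by (auto simp del: mem_Collect_eq)
    qed (use K assms(3) in auto)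
    moreover have "(\<Inter>i\<in>f ` K. A (?g i)) = (\<Inter>j\<in>K. A j)"
      using g by auto
    moreover have "(\<Prod>i\<in>f ` K. prob (A (?g i))) = (\<Prod>j\<in>K. prob (A j))"
      using g inj_on_subset[OF assms(2) K(2)] by (simp add: prod.reindex)
    ultimately show "prob (\<Inter>j\<in>K. A j) = (\<Prod>j\<in>K. prob (A j))"
      by simp
  qed
  then show ?thesis
    using rv assms(3) unfolding indep_vars_def2 by auto
qed

section \<open>Limits of averages of real sequences\<close>

text \<open>One \<open>m\<close> with slack below \<open>u - c\<close> suffices: division by
  \<open>n\<close> removes its constant \<open>B\<close>. The slack is indexed by natural numbers so
  that almost sure bounds can be combined over all \<open>m\<close>.\<close>

lemma eventually_average_less:
  fixes s :: "nat \<Rightarrow> real"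
  assumes "\<And>m::nat. \<exists>B. \<forall>n. s n \<le> real n * (c + 1 / real (Suc m)) + B" and "c < u"
  shows "\<forall>\<^sub>F n in sequentially. s n / real n < u"
proof -
  obtain m where m: "1 / real (Suc m) < u - c"
    using assms(2) nat_approx_posE[of "u - c"] by auto
  obtain B where B: "\<And>n. s n \<le> real n * (c + 1 / real (Suc m)) + B"
    using assms(1) by blast
  have "(\<lambda>n. (c + 1 / real (Suc m)) + B / real n) \<longlonglongrightarrow> (c + 1 / real (Suc m)) + 0"
    by (intro tendsto_intros tendsto_divide_0[OF tendsto_const] filterlim_real_sequentially
        filterlim_at_top_imp_at_infinity)
  then have "\<forall>\<^sub>F n in sequentially. (c + 1 / real (Suc m)) + B / real n < u"
    using m by (intro order_tendstoD) auto
  then show ?thesis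
    using eventually_gt_at_top[of 0]
  proof eventually_elim
    case (elim n)
    have "s n / real n \<le> (real n * (c + 1 / real (Suc m)) + B) / real n"
      using B[of n] elim by (intro divide_right_mono) auto
    also have "\<dots> = (c + 1 / real (Suc m)) + B / real n"
      using elim by (simp add: add_divide_distrib)
    finally show ?case using elim by simp
  qed
qed

text \<open>The one-sided estimate for \<open>s\<close> and for its negative gives the upper and the
  lower half of the limit.\<close>

lemma average_tendstoI:
  fixes s :: "nat \<Rightarrow> real"
  assumes "\<And>m::nat. \<exists>B. \<forall>n. s n \<le> real n * (c + 1 / real (Suc m)) + B"
    and "\<And>m::nat. \<exists>B. \<forall>n. - s n \<le> real n * (- c + 1 / real (Suc m)) + B"
  shows "(\<lambda>n. s n / real n) \<longlonglongrightarrow> c"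
proof (rule order_tendstoI)
  fix l assume "l < c"
  then show "\<forall>\<^sub>F n in sequentially. l < s n / real n"
    using eventually_average_less[of "\<lambda>n. - s n" "- c" "- l"] assms(2) by simp
next
  fix u assume "c < u"
  then show "\<forall>\<^sub>F n in sequentially. s n / real n < u"
    using assms(1) by (intro eventually_average_less)
qed

text \<open>The two averages differ by at most the uniform distance of the weights times the average
  of \<open>q\<close>, which is eventually bounded because it converges.\<close>

lemma weighted_average_perturbation:
  fixes q :: "nat \<Rightarrow> real" and w :: "'a \<Rightarrow> real"
  assumes unif: "uniform_limit UNIV wn w sequentially"
    and q: "\<And>k. 0 \<le> q k"
    and avg: "(\<lambda>n. 1 / real n * (\<Sum>k=1..n. q k)) \<longlonglongrightarrow> Q"
    and lim: "(\<lambda>n. 1 / real n * (\<Sum>k=1..n. w (x k) * q k)) \<longlonglongrightarrow> L"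
  shows "(\<lambda>n. 1 / real n * (\<Sum>k=1..n. wn n (x k) * q k)) \<longlonglongrightarrow> L"
proof -
  let ?A = "\<lambda>n v. 1 / real n * (\<Sum>k=1..n. v k * q k)"
  have Q: "0 \<le> Q"
    by (rule tendsto_lowerbound[OF avg]) (auto intro!: always_eventually sum_nonneg divide_nonneg_nonneg q)
  have "(\<lambda>n. ?A n (\<lambda>k. wn n (x k)) - ?A n (\<lambda>k. w (x k))) \<longlonglongrightarrow> 0"
  proof (rule tendstoI)
    fix e :: real assume "0 < e"
    \<comment> \<open>\<open>Q + 1\<close> is positive and eventually exceeds the averages of
      \<open>q\<close>.\<close>
    define d where "d = e / (Q + 1)"
    have d: "0 < d" "d * (Q + 1) = e"
      using \<open>0 < e\<close> Q by (auto simp: d_def)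
    have "\<forall>\<^sub>F n in sequentially. \<forall>y. \<bar>wn n y - w y\<bar> < d"
      using uniform_limitD[OF unif d(1)] by (simp add: dist_real_def)
    moreover have "\<forall>\<^sub>F n in sequentially. 1 / real n * (\<Sum>k=1..n. q k) < Q + 1"
      using avg by (rule order_tendstoD) simp
    ultimately show "\<forall>\<^sub>F n in sequentially.
        dist (?A n (\<lambda>k. wn n (x k)) - ?A n (\<lambda>k. w (x k))) 0 < e"
    proof eventually_elim
      case (elim n)
      have le: "\<bar>wn n y - w y\<bar> \<le> d" for y
        using elim(1) less_imp_le by blast
      have "?A n (\<lambda>k. wn n (x k)) - ?A n (\<lambda>k. w (x k)) = 1 / real n * (\<Sum>k=1..n. (wn n (x k) - w (x k)) * q k)"
        by (simp add: left_diff_distrib sum_subtractf diff_divide_distrib)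
      also have "\<bar>\<dots>\<bar> \<le> 1 / real n * (\<Sum>k=1..n. d * q k)"
        unfolding abs_mult using le q
        by (intro mult_mono order.trans[OF sum_abs] sum_mono)
           (auto simp: abs_mult intro!: mult_right_mono sum_nonneg)
      also have "\<dots> = d * (1 / real n * (\<Sum>k=1..n. q k))"
        by (simp add: sum_distrib_left[symmetric])
      also have "\<dots> < e"
        using elim(2) d mult_strict_left_mono[OF elim(2) d(1)] by simp
      finally show ?case by simp
    qed
  qed
  from tendsto_add[OF this lim] show ?thesis by simp
qed

section \<open>Regularity and uniform convergence of the weight\<close>

text \<open>The integrals differ by at most the uniform distance of the integrands times the length
  of the interval, whatever the upper limit \<open>x\<close>.\<close>

lemma uniform_limit_indefinite_integral:
  fixes f :: "real \<Rightarrow> real"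
  assumes unif: "uniform_limit {a..b} fn f F"
    and cont: "\<forall>\<^sub>F n in F. continuous_on {a..b} (fn n)" and f: "continuous_on {a..b} f"
  shows "uniform_limit {a..b} (\<lambda>n x. LBINT y:{a..x}. fn n y) (\<lambda>x. LBINT y:{a..x}. f y) F"
proof (rule uniform_limitI)
  fix e :: real assume "0 < e"
  \<comment> \<open>The added 1 avoids division by zero and makes the final bound strict.\<close>
  define d where "d = e / (\<bar>b - a\<bar> + 1)"
  have d: "0 < d" "d * \<bar>b - a\<bar> < e"
    using \<open>0 < e\<close> by (auto simp: d_def field_simps)
  show "\<forall>\<^sub>F n in F. \<forall>x\<in>{a..b}. dist (LBINT y:{a..x}. fn n y) (LBINT y:{a..x}. f y) < e"
    using uniform_limitD[OF unif d(1)] cont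
  proof eventually_elim
    case (elim n)
    show ?case
    proof
      fix x assume x: "x \<in> {a..b}"
      have c: "continuous_on {a..x} (fn n)" "continuous_on {a..x} f"
        using elim(2) f x by (auto elim: continuous_on_subset)
      have "(LBINT y:{a..x}. fn n y) - (LBINT y:{a..x}. f y) = (LBINT y:{a..x}. fn n y - f y)"
        using c by (intro set_integral_diff(2)[symmetric] borel_integrable_atLeastAtMost')
      also have "\<dots> = integral {a..x} (\<lambda>y. fn n y - f y)"
        using c by (intro set_borel_integral_eq_integral borel_integrable_atLeastAtMost' continuous_intros)
      also have "norm \<dots> \<le> d * (x - a)"
        using c x elim(1) by (intro integral_bound continuous_intros)
          (auto simp: dist_real_def intro!: less_imp_le)
      also have "\<dots> \<le> d * \<bar>b - a\<bar>"
        using x d(1) by (intro mult_left_mono) auto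
      finally show "dist (LBINT y:{a..x}. fn n y) (LBINT y:{a..x}. f y) < e"
        using d(2) by (simp add: dist_real_def)
    qed
  qed
qed

lemma continuous_on_indefinite_LBINT:
  fixes f :: "real \<Rightarrow> real"
  assumes "continuous_on {a..b} f"
  shows "continuous_on {a..b} (\<lambda>x. LBINT y:{a..x}. f y)"
proof -
  have "continuous_on {a..b} (\<lambda>x. integral {a..x} f)"
    by (intro indefinite_integral_continuous_1 integrable_continuous_real assms)
  moreover have "(LBINT y:{a..x}. f y) = integral {a..x} f" if "x \<in> {a..b}" for x
    using assms that
    by (intro set_borel_integral_eq_integral borel_integrable_atLeastAtMost') (auto elim: continuous_on_subset)
  ultimately show ?thesis
    by (elim continuous_on_eq) simp
qed

lemma continuous_on_C12_star: "g \<in> C12_star a b \<Longrightarrow> continuous_on {a..b} g"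
  by (auto simp: C12_star_def intro: differentiable_imp_continuous_on)

lemma continuous_on_deriv_C12_star: "g \<in> C12_star a b \<Longrightarrow> continuous_on {a..b} (deriv_on a b g)"
  using continuous_on_minus[of "{a..b}" "\<lambda>x. - deriv_on a b g x"]
  by (auto simp: C12_star_def C01_plus_def)

text \<open>The class gives a strict sign only on the open interval; the endpoints come from the two
  extra hypotheses.\<close>

lemma deriv_C12_star_nonzero:
  assumes "g \<in> C12_star a b" "deriv_on a b g a \<noteq> 0" "deriv_on a b g b \<noteq> 0" "x \<in> {a..b}"
  shows "deriv_on a b g x \<noteq> 0"
proof (cases "x = a \<or> x = b")
  case False
  then have "x \<in> {a<..<b}"
    using assms(4) by auto
  then have "0 < deriv_on a b g x \<or> 0 < - deriv_on a b g x"
    using assms(1) unfolding C12_star_def C01_plus_def by blast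
  then show ?thesis by auto
qed (use assms in auto)

lemma regular_density_pos:
  assumes "regular_density a b \<mu> \<rho>" "x \<in> {a..b}"
  shows "0 < \<rho> x"
  using assms by (cases "x = a"; cases "x = b") (auto simp: regular_density_def C01_plus_def)

lemma regular_density_continuous: "regular_density a b \<mu> \<rho> \<Longrightarrow> continuous_on {a..b} \<rho>"
  by (auto simp: regular_density_def C01_plus_def)

lemma weight_eq_divide:
  "x \<in> {a..b} \<Longrightarrow> weight a b \<rho> g x = - (LBINT y:{a..x}. g y * \<rho> y) / (deriv_on a b g x * \<rho> x)"
  by (simp add: weight_def)

lemma continuous_on_weight:
  assumes "g \<in> C12_star a b" "deriv_on a b g a \<noteq> 0" "deriv_on a b g b \<noteq> 0"
    and "regular_density a b \<mu> \<rho>"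
  shows "continuous_on {a..b} (weight a b \<rho> g)"
proof -
  have "continuous_on {a..b} (\<lambda>x. - (LBINT y:{a..x}. g y * \<rho> y) / (deriv_on a b g x * \<rho> x))"
    using assms deriv_C12_star_nonzero[OF assms(1-3)] regular_density_pos[OF assms(4)]
    by (intro continuous_intros continuous_on_indefinite_LBINT continuous_on_C12_star
        continuous_on_deriv_C12_star regular_density_continuous) (auto simp: less_le)
  then show ?thesis
    by (rule continuous_on_eq) (simp add: weight_eq_divide)
qed

lemma bounded_weight:
  assumes "g \<in> C12_star a b" "deriv_on a b g a \<noteq> 0" "deriv_on a b g b \<noteq> 0"
    and "regular_density a b \<mu> \<rho>"
  obtains C where "\<And>x. \<bar>weight a b \<rho> g x\<bar> \<le> C"
proof -
  obtain C where C: "\<And>x. x \<in> {a..b} \<Longrightarrow> \<bar>weight a b \<rho> g x\<bar> \<le> C"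
    using compact_imp_bounded[OF compact_continuous_image[OF continuous_on_weight[OF assms] compact_Icc]]
    unfolding bounded_iff by force
  \<comment> \<open>Compactness bounds the weight on \<open>{a..b}\<close>; the 0 covers all other
    points, where the weight is zero by definition.\<close>
  have "\<bar>weight a b \<rho> g x\<bar> \<le> max C 0" for x
    using C[of x] by (cases "x \<in> {a..b}") (auto simp: weight_def)
  then show thesis by (rule that)
qed

text \<open>The weight equals its product with the indicator of \<open>{a..b}\<close>, so continuity
  there suffices, whatever values \<open>\<rho>\<close> takes elsewhere.\<close>

lemma borel_measurable_weight:
  assumes "g \<in> C12_star a b" "deriv_on a b g a \<noteq> 0" "deriv_on a b g b \<noteq> 0"
    and "regular_density a b \<mu> \<rho>"
  shows "weight a b \<rho> g \<in> borel_measurable borel"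
proof -
  have "(\<lambda>x. indicator {a..b} x *\<^sub>R weight a b \<rho> g x) \<in> borel_measurable borel"
    by (intro borel_measurable_continuous_on_indicator continuous_on_weight[OF assms]) auto
  also have "(\<lambda>x. indicator {a..b} x *\<^sub>R weight a b \<rho> g x) = weight a b \<rho> g"
    by (auto simp: weight_def fun_eq_iff)
  finally show ?thesis .
qed

text \<open>Numerator and denominator converge uniformly to continuous limits on a compact interval.
  The quotient converges because the limit denominator has a positive minimum modulus.\<close>

lemma uniform_limit_weight:
  assumes "a \<le> b"
    and g: "g \<in> C12_star a b" "deriv_on a b g a \<noteq> 0" "deriv_on a b g b \<noteq> 0"
    and \<rho>: "regular_density a b \<mu> \<rho>"
    and gn: "\<forall>\<^sub>F n in F. gn n \<in> C12_star a b"
    and lim: "uniform_limit {a..b} gn g F"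
    and lim': "uniform_limit {a..b} (\<lambda>n. deriv_on a b (gn n)) (deriv_on a b g) F"
  shows "uniform_limit {a..b} (\<lambda>n. weight a b \<rho> (gn n)) (weight a b \<rho> g) F"
proof -
  have bdd: "bounded (h ` {a..b})" if "continuous_on {a..b} h" for h :: "real \<Rightarrow> real"
    using that by (intro compact_imp_bounded compact_continuous_image compact_Icc)
  note cg = continuous_on_C12_star[OF g(1)] and cg' = continuous_on_deriv_C12_star[OF g(1)]
    and c\<rho> = regular_density_continuous[OF \<rho>]
  have num: "uniform_limit {a..b} (\<lambda>n x. LBINT y:{a..x}. gn n y * \<rho> y) (\<lambda>x. LBINT y:{a..x}. g y * \<rho> y) F"
  proof (rule uniform_limit_indefinite_integral)
    show "uniform_limit {a..b} (\<lambda>n y. gn n y * \<rho> y) (\<lambda>y. g y * \<rho> y) F"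
      by (intro uniform_lim_mult lim uniform_limit_const bdd cg c\<rho>)
    show "\<forall>\<^sub>F n in F. continuous_on {a..b} (\<lambda>y. gn n y * \<rho> y)"
      using gn by eventually_elim (intro continuous_intros continuous_on_C12_star c\<rho>)
    show "continuous_on {a..b} (\<lambda>y. g y * \<rho> y)"
      by (intro continuous_intros cg c\<rho>)
  qed
  have den: "uniform_limit {a..b} (\<lambda>n x. deriv_on a b (gn n) x * \<rho> x) (\<lambda>x. deriv_on a b g x * \<rho> x) F"
    by (intro uniform_lim_mult lim' uniform_limit_const bdd cg' c\<rho>)
  have cden: "continuous_on {a..b} (\<lambda>x. norm (deriv_on a b g x * \<rho> x))"
    by (intro continuous_intros cg' c\<rho>)
  \<comment> \<open>The minimum is attained at \<open>x0\<close>, so nonvanishing at this one point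
    gives a uniform lower bound.\<close>
  obtain x0 where x0: "x0 \<in> {a..b}"
    and min: "\<And>x. x \<in> {a..b} \<Longrightarrow> norm (deriv_on a b g x0 * \<rho> x0) \<le> norm (deriv_on a b g x * \<rho> x)"
    using continuous_attains_inf[OF compact_Icc _ cden] \<open>a \<le> b\<close> by auto
  have pos: "0 < norm (deriv_on a b g x0 * \<rho> x0)"
    using deriv_C12_star_nonzero[OF g x0] regular_density_pos[OF \<rho> x0] by simp
  have "uniform_limit {a..b}
      (\<lambda>n x. - (LBINT y:{a..x}. gn n y * \<rho> y) / (deriv_on a b (gn n) x * \<rho> x))
      (\<lambda>x. - (LBINT y:{a..x}. g y * \<rho> y) / (deriv_on a b g x * \<rho> x)) F"
    by (rule uniform_lim_divide[OF uniform_limit_uminus[OF num] den bdd min pos])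
       (intro continuous_intros continuous_on_indefinite_LBINT cg c\<rho>)+
  then show ?thesis
    by (rule iffD1[OF uniform_limit_cong', rotated 2]) (simp_all only: weight_eq_divide)
qed

section \<open>Strong law of large numbers\<close>

lemma distr_compose_cong:
  assumes "distr M N X = distr M N Y" and "X \<in> M \<rightarrow>\<^sub>M N" "Y \<in> M \<rightarrow>\<^sub>M N" "g \<in> N \<rightarrow>\<^sub>M L"
  shows "distr M L (\<lambda>\<omega>. g (X \<omega>)) = distr M L (\<lambda>\<omega>. g (Y \<omega>))"
  using distr_distr[OF assms(4,2)] distr_distr[OF assms(4,3)] assms(1) by (simp add: comp_def)

text \<open>By independence and equal marginals, the joint law of the sequence is an infinite
  product of a single law, so the maximal inequality transfers; the running maximum dominates each
  partial sum.\<close>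

lemma (in prob_space) AE_bounded_sums:
  fixes Z :: "nat \<Rightarrow> 'a \<Rightarrow> real"
  assumes ind: "indep_vars (\<lambda>_. borel) Z UNIV"
    and id: "\<And>k. distr M borel (Z k) = distr M borel (Z 0)"
    and int: "integrable M (Z 0)" and neg: "expectation (Z 0) < 0"
  shows "AE \<omega> in M. \<exists>B. \<forall>n. (\<Sum>k<n. Z k \<omega>) \<le> B"
proof -
  have Z: "random_variable borel (Z k)" for k
    using ind by (auto simp: indep_vars_def)
  let ?N = "distr M borel (Z 0)"
  have marginals: "(\<lambda>k. distr M borel (Z k)) = (\<lambda>_. ?N)"
    by (intro ext id)
  have joint: "distr M (\<Pi>\<^sub>M k\<in>(UNIV::nat set). borel) (\<lambda>\<omega> k. Z k \<omega>) = (\<Pi>\<^sub>M k\<in>(UNIV::nat set). ?N)"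
    using iffD1[OF indep_vars_iff_distr_eq_PiM[OF UNIV_not_empty Z] ind]
    unfolding marginals restrict_UNIV .
  have meas: "(\<lambda>\<omega> k. Z k \<omega>) \<in> M \<rightarrow>\<^sub>M (\<Pi>\<^sub>M k\<in>(UNIV::nat set). borel)"
    using Z by (intro measurable_PiM_single') auto
  have "AE x in (\<Pi>\<^sub>M k\<in>(UNIV::nat set). ?N). \<exists>B::nat. \<forall>n. max_partial_sum n x \<le> real B"
    using Z int neg
    by (intro AE_bounded_max_partial_sum prob_space_distr)
       (auto simp: integrable_distr_eq integral_distr)
  then have "AE \<omega> in M. \<exists>B::nat. \<forall>n. max_partial_sum n (\<lambda>k. Z k \<omega>) \<le> real B"
    unfolding joint[symmetric] by (rule AE_distrD[OF meas])
  then show ?thesis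
    by eventually_elim (meson order.trans sum_le_max_partial_sum)
qed

lemma (in prob_space) AE_sums_le_above_mean:
  fixes Z :: "nat \<Rightarrow> 'a \<Rightarrow> real"
  assumes ind: "indep_vars (\<lambda>_. borel) Z UNIV"
    and id: "\<And>k. distr M borel (Z k) = distr M borel (Z 0)"
    and int: "integrable M (Z 0)"
  shows "AE \<omega> in M. \<forall>m::nat. \<exists>B. \<forall>n. (\<Sum>k<n. Z k \<omega>) \<le> real n * (expectation (Z 0) + 1 / real (Suc m)) + B"
proof (subst AE_all_countable, rule allI)
  fix m :: nat
  let ?c = "expectation (Z 0) + 1 / real (Suc m)"
  have Z [measurable]: "random_variable borel (Z k)" for k
    using ind by (auto simp: indep_vars_def)
  have "distr M borel (\<lambda>\<omega>. Z k \<omega> - ?c) = distr M borel (\<lambda>\<omega>. Z 0 \<omega> - ?c)" for k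
    by (rule distr_compose_cong[OF id]) measurable
  \<comment> \<open>Centering at \<open>?c\<close> leaves the mean
    \<open>- 1 / real (Suc m)\<close>, which is negative.\<close>
  then have "AE \<omega> in M. \<exists>B. \<forall>n. (\<Sum>k<n. Z k \<omega> - ?c) \<le> B"
    using int
    by (intro AE_bounded_sums indep_vars_compose2[OF ind]) (auto simp: prob_space)
  then show "AE \<omega> in M. \<exists>B. \<forall>n. (\<Sum>k<n. Z k \<omega>) \<le> real n * ?c + B"
    by eventually_elim (simp add: sum_subtractf algebra_simps)
qed

text \<open>The bound slightly above the mean is applied to \<open>Z\<close> and to its
  negative.\<close>

theorem (in prob_space) strong_law_of_large_numbers:
  fixes Z :: "nat \<Rightarrow> 'a \<Rightarrow> real"
  assumes ind: "indep_vars (\<lambda>_. borel) Z UNIV"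
    and id: "\<And>k. distr M borel (Z k) = distr M borel (Z 0)"
    and int: "integrable M (Z 0)"
  shows "AE \<omega> in M. (\<lambda>n. (\<Sum>k<n. Z k \<omega>) / real n) \<longlonglongrightarrow> expectation (Z 0)"
proof -
  have Z [measurable]: "random_variable borel (Z k)" for k
    using ind by (auto simp: indep_vars_def)
  have "distr M borel (\<lambda>\<omega>. - Z k \<omega>) = distr M borel (\<lambda>\<omega>. - Z 0 \<omega>)" for k
    by (rule distr_compose_cong[OF id]) measurable
  then have "AE \<omega> in M. \<forall>m::nat. \<exists>B. \<forall>n. (\<Sum>k<n. - Z k \<omega>)
      \<le> real n * (expectation (\<lambda>\<omega>. - Z 0 \<omega>) + 1 / real (Suc m)) + B"
    using int by (intro AE_sums_le_above_mean indep_vars_compose2[OF ind]) auto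
  with AE_sums_le_above_mean[OF assms] show ?thesis
    by eventually_elim (intro average_tendstoI, simp_all add: sum_negf)
qed

text \<open>Adapts the strong law to the sample: indices start at 1, and the limit is written
  through \<open>X\<close>, which shares the law of the sample points.\<close>

lemma (in prob_space) iid_average_tendsto:
  fixes Xs :: "nat \<Rightarrow> 'a \<Rightarrow> real ^ 'd" and h :: "real ^ 'd \<Rightarrow> real"
  assumes iid: "iid_with_law M Xs (distr M borel X)"
    and X [measurable]: "random_variable borel X" and h [measurable]: "h \<in> borel_measurable borel"
    and int: "integrable M (\<lambda>\<omega>. h (X \<omega>))"
  shows "AE \<omega> in M. (\<lambda>n. 1 / real n * (\<Sum>k=1..n. h (Xs k \<omega>))) \<longlonglongrightarrow> expectation (\<lambda>\<omega>. h (X \<omega>))"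
proof -
  have ind: "indep_vars (\<lambda>_. borel) (\<lambda>k. Xs (Suc k)) UNIV"
    using iid unfolding iid_with_law_def
    by (intro indep_vars_reindex[of "\<lambda>_. borel" Xs "{1..}" Suc]) auto
  have Xs [measurable]: "random_variable borel (Xs (Suc k))" for k
    using ind by (auto simp: indep_vars_def)
  have law: "distr M borel (Xs (Suc k)) = distr M borel X" for k
    using iid by (simp add: iid_with_law_def)
  have "distr M borel (\<lambda>\<omega>. h (Xs (Suc k) \<omega>)) = distr M borel (\<lambda>\<omega>. h (Xs (Suc 0) \<omega>))" for k
    by (rule distr_compose_cong[OF _ Xs Xs h]) (simp add: law)
  moreover have "indep_vars (\<lambda>_. borel) (\<lambda>k \<omega>. h (Xs (Suc k) \<omega>)) UNIV"
    by (rule indep_vars_compose2[OF ind]) simp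
  moreover have "integrable M (\<lambda>\<omega>. h (Xs (Suc 0) \<omega>))"
    using integrable_distr_eq[OF Xs[of 0] h] integrable_distr_eq[OF X h] int by (simp add: law)
  moreover have "expectation (\<lambda>\<omega>. h (Xs (Suc 0) \<omega>)) = expectation (\<lambda>\<omega>. h (X \<omega>))"
    using integral_distr[OF Xs[of 0] h] integral_distr[OF X h] by (simp add: law)
  ultimately have "AE \<omega> in M. (\<lambda>n. (\<Sum>k<n. h (Xs (Suc k) \<omega>)) / real n) \<longlonglongrightarrow> expectation (\<lambda>\<omega>. h (X \<omega>))"
    using strong_law_of_large_numbers[of "\<lambda>k \<omega>. h (Xs (Suc k) \<omega>)"] by simp
  moreover have "(\<Sum>k<n. h (Xs (Suc k) \<omega>)) = (\<Sum>k=1..n. h (Xs k \<omega>))" for n \<omega>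
    by (rule sum.reindex_bij_witness[of _ "\<lambda>k. k - 1" Suc]) auto
  ultimately show ?thesis
    by simp
qed

section \<open>Convergence of the estimated weight and of the Monte Carlo estimator\<close>

theorem proposition4p3:
  fixes M :: "'w measure"
    and X :: "'w \<Rightarrow> real ^ 'd"
    and f Df :: "real ^ 'd \<Rightarrow> real"
    and i :: 'd
    and a b :: real
    and \<rho> fi :: "real \<Rightarrow> real"
    and Xs :: "nat \<Rightarrow> 'w \<Rightarrow> real ^ 'd"
    and est :: "(real ^ 'd) list \<Rightarrow> real \<Rightarrow> real"
  defines "\<mu>i \<equiv> distr M borel (\<lambda>\<omega>. X \<omega> $ i)"
    and "fhat \<equiv> (\<lambda>n \<omega>. est (sample Xs n \<omega>))"
  assumes "prob_space M"
    and "X \<in> borel_measurable M"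
    and "prob_space.indep_vars M (\<lambda>_. borel) (\<lambda>j \<omega>. X \<omega> $ j) UNIV"
    and "L2_rv M (\<lambda>\<omega>. f (X \<omega>))"
    and "a < b"
    and "\<mu>i \<in> P_class a b"
    and "regular_density a b \<mu>i \<rho>"
    and "main_effect M X f i fi"
    and "fi \<in> C12_star a b"
    and "deriv_on a b fi a \<noteq> 0"
    and "deriv_on a b fi b \<noteq> 0"
    and "partial_derivative (distr M borel X) f i Df"
    and "L2_rv M (\<lambda>\<omega>. Df (X \<omega>))"
    and "iid_with_law M Xs (distr M borel X)"
    and "AE \<omega> in M. \<forall>n\<ge>1. centered a b \<mu>i (fhat n \<omega>)"
    and "AE \<omega> in M. \<forall>n\<ge>1. fhat n \<omega> \<in> C12_star a b \<and>
           deriv_on a b (fhat n \<omega>) a \<noteq> 0 \<and> deriv_on a b (fhat n \<omega>) b \<noteq> 0"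
    and "AE \<omega> in M. uniform_limit {a..b} (\<lambda>n. fhat n \<omega>) fi sequentially"
    and "AE \<omega> in M. uniform_limit {a..b} (\<lambda>n. deriv_on a b (fhat n \<omega>)) (deriv_on a b fi) sequentially"
  shows "(AE \<omega> in M. uniform_limit {a..b}
            (\<lambda>n. weight a b \<rho> (fhat n \<omega>)) (weight a b \<rho> fi) sequentially) \<and>
         (AE \<omega> in M. (\<lambda>n. dgsm_mc Xs i Df (weight a b \<rho> (fhat n \<omega>)) n \<omega>)
            \<longlonglongrightarrow> dgsm M X i Df (weight a b \<rho> fi))"
proof -
  interpret prob_space M by fact
  note X [measurable] = assms(4)
  note \<rho> = assms(9) and fi = assms(11-13)
  have Df [measurable]: "Df \<in> borel_measurable borel"
    using assms(14) by (simp add: partial_derivative_def)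
  have Df_int: "integrable M (\<lambda>\<omega>. (Df (X \<omega>))\<^sup>2)"
    using assms(15) by (simp add: L2_rv_def)
  let ?w = "weight a b \<rho> fi" and ?wn = "\<lambda>n \<omega>. weight a b \<rho> (fhat n \<omega>)"
  have w [measurable]: "?w \<in> borel_measurable borel"
    by (rule borel_measurable_weight[OF fi \<rho>])
  obtain C where C: "\<And>x. \<bar>?w x\<bar> \<le> C"
    using bounded_weight[OF fi \<rho>] by blast
  have nth [measurable]: "(\<lambda>x::real ^ 'd. x $ i) \<in> borel_measurable borel"
    by (intro borel_measurable_continuous_onI linear_continuous_on bounded_linear_vec_nth)
  have Xi [measurable]: "(\<lambda>\<omega>. X \<omega> $ i) \<in> borel_measurable M"
    by (rule measurable_compose[OF X nth])
  have DfX [measurable]: "(\<lambda>\<omega>. Df (X \<omega>)) \<in> borel_measurable M"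
    by (rule measurable_compose[OF X Df])
  \<comment> \<open>The limit weight is bounded, so a multiple of the squared partial derivative
    dominates.\<close>
  have w_int: "integrable M (\<lambda>\<omega>. ?w (X \<omega> $ i) * (Df (X \<omega>))\<^sup>2)"
  proof (rule Bochner_Integration.integrable_bound)
    show "integrable M (\<lambda>\<omega>. C * (Df (X \<omega>))\<^sup>2)"
      using Df_int by simp
    show "AE \<omega> in M. norm (?w (X \<omega> $ i) * (Df (X \<omega>))\<^sup>2) \<le> norm (C * (Df (X \<omega>))\<^sup>2)"
      using order.trans[OF C abs_ge_self] by (intro AE_I2) (simp add: abs_mult mult_right_mono)
  qed measurable
  have Df_avg: "AE \<omega> in M. (\<lambda>n. 1 / real n * (\<Sum>k=1..n. (Df (Xs k \<omega>))\<^sup>2))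
      \<longlonglongrightarrow> expectation (\<lambda>\<omega>. (Df (X \<omega>))\<^sup>2)"
    by (intro iid_average_tendsto assms X Df_int) measurable
  \<comment> \<open>The strong law is applied to the fixed weight \<open>?w\<close>; the estimated
    weights depend on the whole sample, so their summands need not be independent.\<close>
  have w_avg: "AE \<omega> in M. (\<lambda>n. 1 / real n * (\<Sum>k=1..n. ?w (Xs k \<omega> $ i) * (Df (Xs k \<omega>))\<^sup>2))
      \<longlonglongrightarrow> expectation (\<lambda>\<omega>. ?w (X \<omega> $ i) * (Df (X \<omega>))\<^sup>2)"
    by (rule iid_average_tendsto[OF assms(16) X _ w_int]) measurable
  have unif: "AE \<omega> in M. uniform_limit {a..b} (\<lambda>n. ?wn n \<omega>) ?w sequentially"
    using assms(18-20)
  proof eventually_elim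
    case (elim \<omega>)
    \<comment> \<open>The regularity assumption starts at \<open>n = 1\<close>; the empty sample is
      left out.\<close>
    have "\<forall>\<^sub>F n in sequentially. fhat n \<omega> \<in> C12_star a b"
      using elim(1) by (auto intro: eventually_sequentiallyI[of 1])
    then show ?case
      using uniform_limit_weight[OF less_imp_le[OF \<open>a < b\<close>] fi \<rho> _ elim(2,3)] by blast
  qed
  moreover have "AE \<omega> in M. (\<lambda>n. dgsm_mc Xs i Df (?wn n \<omega>) n \<omega>) \<longlonglongrightarrow> dgsm M X i Df ?w"
    using unif Df_avg w_avg
  proof eventually_elim
    case (elim \<omega>)
    \<comment> \<open>Both weights vanish off \<open>{a..b}\<close>, so convergence is uniform on
      the whole line and sample points can be inserted without checking that they lie in the
      interval.\<close>
    have "uniform_limit UNIV (\<lambda>n. ?wn n \<omega>) ?w sequentially"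
    proof (rule uniform_limitI)
      fix e :: real assume "0 < e"
      show "\<forall>\<^sub>F n in sequentially. \<forall>x\<in>UNIV. dist (?wn n \<omega> x) (?w x) < e"
        using uniform_limitD[OF elim(1) \<open>0 < e\<close>]
      proof eventually_elim
        case (elim n)
        then have "dist (?wn n \<omega> x) (?w x) < e" for x
          using \<open>0 < e\<close> by (cases "x \<in> {a..b}") (auto simp: weight_def)
        then show ?case by blast
      qed
    qed
    from weighted_average_perturbation[OF this _ elim(2,3)] show ?case
      by (simp add: dgsm_mc_def dgsm_def)
  qed
  ultimately show ?thesis ..
qed

end
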